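(* For every integer $k\geq 5$, the graph $G_k$ defined in the context satisfies $\operatorname{sdiam}_k(G_k)=k+3$ and $\operatorname{srad}_k(G_k)=k+1$.
   Context: Graphs are finite, simple and undirected. The size of a graph is its number of edges. For a connected graph $G$ and a non-empty set $S\subseteq V(G)$, the Steiner distance $d(S)$ is the minimum size (number of edges) of a connected subgraph of $G$ containing all vertices of $S$. For an integer $k$ with $2\le k\le |V(G)|$ and $v\in V(G)$, the Steiner $k$-eccentricity of $v$ is $\operatorname{e}_k(v)=\max\{d(S): S\subseteq V(G),\ |S|=k,\ v\in S\}$. The Steiner $k$-radius is $\operatorname{srad}_k(G)=\min\{\operatorname{e}_k(v):v\in V(G)\}$ and the Steiner $k$-diameter is $\operatorname{sdiam}_k(G)=\max\{\operatorname{e}_k(v):v\in V(G)\}$. Construction of $G_k$ for an integer $k\ge 5$: let $m=\lceil \frac{k+1}{2}\rceil$. Start with $k$ independent vertices $D=\{d_1,\ldots,d_k\}$ and put $D_1=\{d_1,\ldots,d_m\}$ and $D_2=\{d_m,d_{m+1},\ldots,d_k\}$ (so $D_1\cap D_2=\{d_m\}$). For each $d_i\in D_1$ add a new vertex $a_i$ adjacent to exactly the vertices of $D_1\setminus\{d_i\}$, and let $A$ be the set of all the $a_i$ ($1\le i\le m$). For each $d_j\in D_2$ add a new vertex $b_j$ adjacent to exactly the vertices of $D_2\setminus\{d_j\}$, and let $B$ be the set of all the $b_j$ ($m\le j\le k$). Finally add a new vertex $r$ adjacent to every vertex of $A\cup B$ (and to no other vertex). There are no further vertices or edges. *)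

theory Defs
  imports Complex_Main "Graph_Theory.Graph_Theory"
begin

section \<open>Steiner distances in finite simple graphs\<close>

text \<open>
  A finite simple undirected graph is a \<^locale>\<open>pair_graph\<close>, that is, a finite, loop-free
  digraph with a symmetric set of arcs \<^term>\<open>parcs G\<close>.  Each undirected edge is
  represented by two opposite arcs, which are counted once in the size.
\<close>

definition edge_count :: "'a pair_pre_digraph \<Rightarrow> nat" where
  "edge_count G = card {{u, v} | u v. (u, v) \<in> parcs G}"

text \<open>
  The subgraph ranges over all undirected subgraphs, not only over induced ones.  The value is
  meaningful if some connected subgraph of \<^term>\<open>G\<close> contains \<^term>\<open>S\<close>, in particular
  if \<^term>\<open>G\<close> is connected and \<^term>\<open>S \<subseteq> pverts G\<close>.
\<close>

definition steiner_distance :: "'a pair_pre_digraph \<Rightarrow> 'a set \<Rightarrow> nat" where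
  "steiner_distance G S =
     (LEAST n. \<exists>H. pair_graph H \<and> subgraph (with_proj H) (with_proj G) \<and>
                   connected (with_proj H) \<and> S \<subseteq> pverts H \<and> edge_count H = n)"

definition steiner_ecc :: "nat \<Rightarrow> 'a pair_pre_digraph \<Rightarrow> 'a \<Rightarrow> nat" where
  "steiner_ecc k G v =
     Max {steiner_distance G S | S. S \<subseteq> pverts G \<and> card S = k \<and> v \<in> S}"

definition srad :: "nat \<Rightarrow> 'a pair_pre_digraph \<Rightarrow> nat" where
  "srad k G = Min (steiner_ecc k G ` pverts G)"

definition sdiam :: "nat \<Rightarrow> 'a pair_pre_digraph \<Rightarrow> nat" where
  "sdiam k G = Max (steiner_ecc k G ` pverts G)"


section \<open>The graph $G_k$\<close>

datatype gk_vertex = D nat | A nat | B nat | R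

definition gk_m :: "nat \<Rightarrow> nat" where
  "gk_m k = nat \<lceil>(real k + 1) / 2\<rceil>"

definition gk_edges :: "nat \<Rightarrow> (gk_vertex \<times> gk_vertex) set" where
  "gk_edges k =
     {(A i, D j) | i j. i \<in> {1..gk_m k} \<and> j \<in> {1..gk_m k} \<and> i \<noteq> j} \<union>
     {(B i, D j) | i j. i \<in> {gk_m k..k} \<and> j \<in> {gk_m k..k} \<and> i \<noteq> j} \<union>
     {(R, A i) | i. i \<in> {1..gk_m k}} \<union>
     {(R, B j) | j. j \<in> {gk_m k..k}}"

definition Gk :: "nat \<Rightarrow> gk_vertex pair_pre_digraph" where
  "Gk k = \<lparr> pverts = D ` {1..k} \<union> A ` {1..gk_m k} \<union> B ` {gk_m k..k} \<union> {R},
            parcs = gk_edges k \<union> (gk_edges k)\<inverse> \<rparr>"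

lemma gk_m_bounds:
  assumes "k \<ge> 5"
  shows "3 \<le> gk_m k" "gk_m k + 2 \<le> k"
proof -
  define c where "c = \<lceil>(real k + 1) / 2\<rceil>"
  have "of_int c - 1 < (real k + 1) / 2 \<and> (real k + 1) / 2 \<le> of_int c"
    unfolding c_def by (rule ceiling_correct)
  then have "real k + 1 \<le> 2 * of_int c" "2 * of_int c < real k + 3"
    by (simp_all add: field_simps)
  then have "int k + 1 \<le> 2 * c" "2 * c < int k + 3" by linarith+
  then show "3 \<le> gk_m k" "gk_m k + 2 \<le> k"
    using assms by (simp_all add: gk_m_def c_def[symmetric])
qed

lemma pair_graph_Gk:
  assumes "k \<ge> 5"
  shows "pair_graph (Gk k)"
proof
  show "finite (pverts (Gk k))" by (simp add: Gk_def)
  have sub: "parcs (Gk k) \<subseteq> pverts (Gk k) \<times> pverts (Gk k)"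
    using gk_m_bounds[OF assms] by (auto simp: Gk_def gk_edges_def)
  show "finite (parcs (Gk k))"
    by (rule finite_subset[OF sub]) (simp add: Gk_def)
  show "fst e \<in> pverts (Gk k)" "snd e \<in> pverts (Gk k)" if "e \<in> parcs (Gk k)" for e
    using that sub by auto
  show "fst e \<noteq> snd e" if "e \<in> parcs (Gk k)" for e
    using that by (auto simp: Gk_def gk_edges_def)
  show "symmetric (with_proj (Gk k))"
    by (auto simp: symmetric_def arcs_ends_conv sym_def Gk_def)
qed

lemma card_pverts_Gk:
  assumes "k \<ge> 5"
  shows "card (pverts (Gk k)) = 2 * k + 2"
proof -
  have "card (D ` {1..k} \<union> A ` {1..gk_m k}) = card (D ` {1..k}) + card (A ` {1..gk_m k})"
    by (rule card_Un_disjoint) auto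
  moreover have "card (D ` {1..k} \<union> A ` {1..gk_m k} \<union> B ` {gk_m k..k}) =
      card (D ` {1..k} \<union> A ` {1..gk_m k}) + card (B ` {gk_m k..k})"
    by (rule card_Un_disjoint) auto
  moreover have "card (pverts (Gk k)) =
      card (D ` {1..k} \<union> A ` {1..gk_m k} \<union> B ` {gk_m k..k}) + card {R}"
    unfolding Gk_def pair_pre_digraph.simps by (rule card_Un_disjoint) auto
  ultimately have "card (pverts (Gk k)) =
      card (D ` {1..k}) + card (A ` {1..gk_m k}) + card (B ` {gk_m k..k}) + card {R}"
    by linarith
  then show ?thesis
    using gk_m_bounds[OF assms] by (simp add: card_image inj_on_def)
qed

lemma connected_Gk:
  assumes "k \<ge> 5"
  shows "connected (with_proj (Gk k))"
proof -
  interpret pair_graph "Gk k" by (rule pair_graph_Gk[OF assms])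
  note m = gk_m_bounds[OF assms]
  have step: "u \<rightarrow>\<^sup>*\<^bsub>with_proj (Gk k)\<^esub> v" if "(u, v) \<in> gk_edges k \<union> (gk_edges k)\<inverse>" for u v
    using that by (intro reachable_adjI) (auto simp: Gk_def)
  have toR: "u \<rightarrow>\<^sup>*\<^bsub>with_proj (Gk k)\<^esub> R" if "u \<in> pverts (Gk k)" for u
  proof -
    have RR: "R \<rightarrow>\<^sup>*\<^bsub>with_proj (Gk k)\<^esub> R"
      by (rule reachable_refl) (simp add: Gk_def)
    have AR: "A i \<rightarrow>\<^sup>*\<^bsub>with_proj (Gk k)\<^esub> R" if "i \<in> {1..gk_m k}" for i
      using that by (intro step) (auto simp: gk_edges_def)
    have BR: "B i \<rightarrow>\<^sup>*\<^bsub>with_proj (Gk k)\<^esub> R" if "i \<in> {gk_m k..k}" for i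
      using that by (intro step) (auto simp: gk_edges_def)
    have DR: "D j \<rightarrow>\<^sup>*\<^bsub>with_proj (Gk k)\<^esub> R" if "j \<in> {1..k}" for j
    proof (cases "j \<le> gk_m k")
      case True
      define i where "i = (if j = 1 then 2 else 1 :: nat)"
      have i: "i \<in> {1..gk_m k}" "i \<noteq> j" using m by (auto simp: i_def)
      have "D j \<rightarrow>\<^sup>*\<^bsub>with_proj (Gk k)\<^esub> A i"
        using i that True by (intro step) (auto simp: gk_edges_def)
      then show ?thesis using AR[OF i(1)] by (rule reachable_trans)
    next
      case False
      have i: "gk_m k \<in> {gk_m k..k}" using m by auto
      have "D j \<rightarrow>\<^sup>*\<^bsub>with_proj (Gk k)\<^esub> B (gk_m k)"
        using i that False by (intro step) (auto simp: gk_edges_def)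
      then show ?thesis using BR[OF i] by (rule reachable_trans)
    qed
    show ?thesis using that RR AR BR DR by (auto simp: Gk_def)
  qed
  have "u \<rightarrow>\<^sup>*\<^bsub>with_proj (Gk k)\<^esub> v" if "u \<in> pverts (Gk k)" "v \<in> pverts (Gk k)" for u v
    using toR[OF that(1)] symmetric_reachable[OF sym_arcs toR[OF that(2)]]
    by (rule reachable_trans)
  then have "u \<rightarrow>\<^sup>*\<^bsub>with_proj (mk_symmetric (with_proj (Gk k)))\<^esub> v"
    if "u \<in> pverts (Gk k)" "v \<in> pverts (Gk k)" for u v
    using that by (blast intro: reachable_mk_symmetricI)
  moreover have "pverts (Gk k) \<noteq> {}" by (simp add: Gk_def)
  ultimately show ?thesis by (simp add: connected_def strongly_connected_def)
qed

end

theory Submission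
  imports Defs
begin

text \<open>
  A connected subgraph on \<open>n\<close> vertices has at least \<open>n - 1\<close> edges, with equality for trees, so a
  Steiner distance is one less than the number of vertices of a smallest connected vertex set
  containing \<open>S\<close>.  Without \<open>R\<close>, the two sides of $G_k$ communicate only through
  \<open>D m\<close>.  A connected set containing all \<open>D i\<close> except possibly \<open>D m\<close> therefore has at least
  \<open>k + 2\<close> vertices, and one containing all \<open>D i\<close> has at least \<open>k + 4\<close>.  Conversely, if
  \<open>S\<close> misses some \<open>D i\<close>, then one \<open>A\<close> and one \<open>B\<close> suffice to dominate the other
  \<open>D j\<close>, and \<open>R\<close> joins these two.
\<close>

section \<open>Steiner distances and connected vertex sets\<close>

text \<open>Connectedness phrased by cuts: for symmetric \<open>E\<close> and non-empty
  \<open>W\<close> it says that \<open>E\<close> connects \<open>W\<close> using vertices of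
  \<open>W\<close> only. Lower bounds then need one well-chosen cut instead of an analysis of
  paths.\<close>

definition cut_connected :: "('a \<times> 'a) set \<Rightarrow> 'a set \<Rightarrow> bool" where
  "cut_connected E W \<longleftrightarrow> (\<forall>X. X \<noteq> {} \<and> X \<subset> W \<longrightarrow> (\<exists>u\<in>X. \<exists>v\<in>W - X. (u, v) \<in> E))"

text \<open>Here \<open>X\<close> need not lie inside \<open>W\<close>, so a cut can be described
  without reference to \<open>W\<close>.\<close>

lemma cut_connectedE:
  assumes "cut_connected E W" "x \<in> W" "x \<in> X" "y \<in> W" "y \<notin> X"
  obtains u v where "u \<in> W" "u \<in> X" "v \<in> W" "v \<notin> X" "(u, v) \<in> E"
proof -
  have "X \<inter> W \<noteq> {} \<and> X \<inter> W \<subset> W" using assms by blast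
  then obtain u v where "u \<in> X \<inter> W" "v \<in> W - X \<inter> W" "(u, v) \<in> E"
    using assms(1)[unfolded cut_connected_def, rule_format, of "X \<inter> W"] by blast
  then show ?thesis using that[of u v] by auto
qed

lemma cut_connected_mono:
  assumes "cut_connected E W" "E \<subseteq> F"
  shows "cut_connected F W"
  using assms unfolding cut_connected_def by (meson subsetD)

lemma (in pair_graph) connected_imp_cut_connected:
  assumes "connected G"
  shows "cut_connected (parcs G) (pverts G)"
  unfolding cut_connected_def
proof (intro allI impI)
  fix X assume X: "X \<noteq> {} \<and> X \<subset> pverts G"
  then obtain x y where xy: "x \<in> X" "x \<in> pverts G" "y \<in> pverts G" "y \<notin> X" by blast
  have "x \<rightarrow>\<^sup>*\<^bsub>mk_symmetric G\<^esub> y"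
    using assms xy by (auto simp: connected_def strongly_connected_def)
  then have reach: "x \<rightarrow>\<^sup>*\<^bsub>G\<^esub> y"
    using reachable_mk_symmetric_eq sym_arcs by blast
  show "\<exists>u\<in>X. \<exists>v\<in>pverts G - X. (u, v) \<in> parcs G"
  proof (rule ccontr)
    assume no: "\<not> ?thesis"
    \<comment> \<open>If no arc left \<open>X\<close>, a walk starting at \<open>x\<close> could
      never leave \<open>X\<close>.\<close>
    from reach have "y \<in> X"
    proof (induction rule: reachable_induct)
      case base
      show ?case by (rule xy(1))
    next
      case (step u v)
      then have "(u, v) \<in> parcs G" by simp
      then have "v \<in> pverts G" by (rule in_arcsD2)
      then show ?case using no \<open>(u, v) \<in> parcs G\<close> \<open>u \<in> X\<close> by blast
    qed
    then show False using xy by simp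
  qed
qed

lemma edge_count_le_card:
  assumes "finite W" "parcs G = {(w, p w) | w. w \<in> W} \<union> {(w, p w) | w. w \<in> W}\<inverse>"
  shows "edge_count G \<le> card W"
proof -
  have "{{u, v} | u v. (u, v) \<in> parcs G} \<subseteq> (\<lambda>w. {w, p w}) ` W"
    by (auto simp: assms(2) insert_commute)
  then have "edge_count G \<le> card ((\<lambda>w. {w, p w}) ` W)"
    unfolding edge_count_def using assms(1) by (intro card_mono) auto
  also have "\<dots> \<le> card W" using assms(1) by (rule card_image_le)
  finally show ?thesis .
qed

text \<open>Grow a vertex set \<open>X\<close> from a single vertex. While \<open>X\<close> is
  proper, the cut condition yields an edge to some \<open>v\<close> outside \<open>X\<close>; this
  edge is not yet among the edges inside \<open>X\<close>, so each added vertex brings at least one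
  new edge.\<close>

lemma (in pair_graph) card_le_edge_count:
  assumes "cut_connected (parcs G) (pverts G)" and "pverts G \<noteq> {}"
  shows "card (pverts G) \<le> Suc (edge_count G)"
proof -
  define edges where "edges X = {{u, v} | u v. (u, v) \<in> parcs G \<and> u \<in> X \<and> v \<in> X}" for X
  have fin: "finite (edges X)" for X
  proof (rule finite_subset)
    show "edges X \<subseteq> (\<lambda>(u, v). {u, v}) ` parcs G" by (auto simp: edges_def)
    show "finite ((\<lambda>(u, v). {u, v}) ` parcs G)" using pair_finite_arcs by simp
  qed
  have grow: "\<exists>X\<subseteq>pverts G. card X = Suc n \<and> n \<le> card (edges X)"
    if "Suc n \<le> card (pverts G)" for n
    using that
  proof (induction n)
    case 0
    obtain x where "x \<in> pverts G" using assms(2) by blast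
    then show ?case by (intro exI[of _ "{x}"]) auto
  next
    case (Suc n)
    then obtain X where X: "X \<subseteq> pverts G" "card X = Suc n" "n \<le> card (edges X)" by auto
    have finX: "finite X" using X(1) pair_finite_verts by (rule finite_subset)
    have "X \<noteq> {}" "X \<noteq> pverts G" using X Suc.prems by auto
    then obtain u v where uv: "u \<in> X" "v \<in> pverts G" "v \<notin> X" "(u, v) \<in> parcs G"
      using assms(1) X(1) unfolding cut_connected_def by blast
    have "{u, v} \<notin> edges X" using uv(3) by (auto simp: edges_def doubleton_eq_iff)
    moreover have "insert {u, v} (edges X) \<subseteq> edges (insert v X)"
      using uv by (auto simp: edges_def)
    then have "card (insert {u, v} (edges X)) \<le> card (edges (insert v X))"
      by (intro card_mono fin)
    ultimately have "Suc n \<le> card (edges (insert v X))" using X(3) fin by simp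
    then show ?case using X uv finX by (intro exI[of _ "insert v X"]) auto
  qed
  obtain n where n: "card (pverts G) = Suc n"
    using assms(2) pair_finite_verts by (metis card_eq_0_iff not0_implies_Suc)
  then obtain X where X: "X \<subseteq> pverts G" "card X = Suc n" "n \<le> card (edges X)"
    using grow[of n] by auto
  then have "X = pverts G" using n pair_finite_verts by (metis card_subset_eq)
  moreover have "edges (pverts G) = {{u, v} | u v. (u, v) \<in> parcs G}"
    unfolding edges_def using in_arcsD1 in_arcsD2 by blast
  ultimately show ?thesis using X n by (simp add: edge_count_def)
qed

text \<open>Replaces edge counts by vertex counts: the vertex set of an optimal subgraph is
  cut-connected in that subgraph, hence also in \<open>G\<close>.\<close>

lemma le_steiner_distance:
  assumes "pair_graph G" "connected (with_proj G)" "S \<subseteq> pverts G"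
    and "\<And>W. \<lbrakk>W \<subseteq> pverts G; S \<subseteq> W; cut_connected (parcs G) W\<rbrakk> \<Longrightarrow> Suc n \<le> card W"
  shows "n \<le> steiner_distance G S"
proof -
  interpret pair_graph G by fact
  let ?P = "\<lambda>n. \<exists>H. pair_graph H \<and> subgraph (with_proj H) (with_proj G) \<and>
    connected (with_proj H) \<and> S \<subseteq> pverts H \<and> edge_count H = n"
  \<comment> \<open>\<open>G\<close> itself is a candidate, so the \<open>LEAST\<close> is
    attained.\<close>
  have "?P (edge_count G)"
    using assms(1-3) subgraph_refl by (intro exI[of _ G]) simp
  then have "?P (steiner_distance G S)"
    unfolding steiner_distance_def by (rule LeastI[of ?P])
  then obtain H where H: "pair_graph H" "subgraph (with_proj H) (with_proj G)"
    "connected (with_proj H)" "S \<subseteq> pverts H" "edge_count H = steiner_distance G S" by blast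
  interpret H: pair_graph H by fact
  have sub: "pverts H \<subseteq> pverts G" "parcs H \<subseteq> parcs G" using H(2) by (auto simp: subgraph_def)
  have cut: "cut_connected (parcs H) (pverts H)"
    by (rule H.connected_imp_cut_connected) fact
  have "pverts H \<noteq> {}" using H(3) by (auto simp: connected_def strongly_connected_def)
  then have "card (pverts H) \<le> Suc (edge_count H)" by (rule H.card_le_edge_count[OF cut])
  moreover have "Suc n \<le> card (pverts H)"
    using sub(1) H(4) cut_connected_mono[OF cut sub(2)] by (rule assms(4))
  ultimately show ?thesis using H(5) by simp
qed

text \<open>The rank \<open>f\<close> makes the edges from each vertex to a neighbour of smaller rank a spanning
  tree of \<open>W\<close> rooted at \<open>c\<close>.\<close>

lemma steiner_distance_le:
  fixes f :: "'a \<Rightarrow> nat"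
  assumes "pair_graph G" "W \<subseteq> pverts G" "c \<in> W" "S \<subseteq> W"
    and parent: "\<And>w. \<lbrakk>w \<in> W; w \<noteq> c\<rbrakk> \<Longrightarrow> \<exists>q\<in>W. (w, q) \<in> parcs G \<and> f q < f w"
  shows "steiner_distance G S \<le> card W - 1"
proof -
  interpret pair_graph G by fact
  have finW: "finite W" using assms(2) pair_finite_verts by (rule finite_subset)
  obtain p where p: "\<And>w. w \<in> W - {c} \<Longrightarrow> p w \<in> W \<and> (w, p w) \<in> parcs G \<and> f (p w) < f w"
    using parent by (metis DiffE singletonI)
  define E where "E = {(w, p w) | w. w \<in> W - {c}}"
  define H where "H = \<lparr>pverts = W, parcs = E \<union> E\<inverse>\<rparr>"
  have H: "pverts H = W" "parcs H = E \<union> E\<inverse>" by (simp_all add: H_def)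
  have EG: "E \<union> E\<inverse> \<subseteq> parcs G" "E \<union> E\<inverse> \<subseteq> W \<times> W"
    using p arcs_symmetric by (auto simp: E_def)
  have "pair_graph H"
  proof
    show "finite (pverts H)" using finW by (simp add: H)
    show "finite (parcs H)"
      using finite_subset[OF EG(2)] finW by (simp add: H)
    show "fst e \<in> pverts H" "snd e \<in> pverts H" if "e \<in> parcs H" for e
      using that EG(2) by (auto simp: H)
    show "fst e \<noteq> snd e" if "e \<in> parcs H" for e
      using that EG(1) no_loops' by (cases e) (auto simp: H)
    show "symmetric (with_proj H)"
      by (auto simp: symmetric_def arcs_ends_conv sym_def H_def)
  qed
  then interpret H: pair_graph H .
  have toc: "w \<rightarrow>\<^sup>*\<^bsub>H\<^esub> c" if "w \<in> W" for w
    using that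
  proof (induction "f w" arbitrary: w rule: less_induct)
    case less
    show ?case
    proof (cases "w = c")
      case True
      then show ?thesis using less.prems H.reachable_refl[of c] H(1) by simp
    next
      case False
      then have "w \<in> W - {c}" using less.prems by simp
      then have "(w, p w) \<in> parcs H" "p w \<rightarrow>\<^sup>*\<^bsub>H\<^esub> c"
        using p less.hyps by (auto simp: H(2) E_def)
      then show ?thesis by (rule H.adj_reachable_trans)
    qed
  qed
  have "u \<rightarrow>\<^sup>*\<^bsub>H\<^esub> v" if "u \<in> W" "v \<in> W" for u v
    using toc[OF that(1)] symmetric_reachable[OF H.sym_arcs toc[OF that(2)]]
    by (rule H.reachable_trans)
  then have "u \<rightarrow>\<^sup>*\<^bsub>mk_symmetric H\<^esub> v" if "u \<in> W" "v \<in> W" for u v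
    using that by (blast intro: H.reachable_mk_symmetricI)
  then have conn: "connected (with_proj H)"
    using assms(3) by (auto simp: connected_def strongly_connected_def H(1))
  have sub: "subgraph (with_proj H) (with_proj G)"
    using EG(1) assms(2) H.wf_digraph_axioms wf_digraph_axioms
    by (auto simp: subgraph_def H_def compatible_def)
  have "steiner_distance G S \<le> edge_count H"
    unfolding steiner_distance_def using \<open>pair_graph H\<close> sub conn assms(4)
    by (intro Least_le exI[of _ H]) (simp add: H)
  \<comment> \<open>The root \<open>c\<close> has no parent edge, which gives the
    \<open>- 1\<close>.\<close>
  also have "\<dots> \<le> card (W - {c})"
    using finW by (intro edge_count_le_card[of _ _ p]) (auto simp: H E_def)
  finally show ?thesis using assms(3) finW by simp
qed

section \<open>Eccentricities\<close>

lemma finite_steiner_distances: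
  assumes "finite (pverts G)"
  shows "finite {steiner_distance G S | S. S \<subseteq> pverts G \<and> card S = k \<and> v \<in> S}"
  using assms by (auto intro: finite_subset[of _ "steiner_distance G ` Pow (pverts G)"])

lemma le_steiner_ecc:
  assumes "finite (pverts G)" "S \<subseteq> pverts G" "card S = k" "v \<in> S" "n \<le> steiner_distance G S"
  shows "n \<le> steiner_ecc k G v"
proof -
  have "steiner_distance G S \<le> steiner_ecc k G v"
    unfolding steiner_ecc_def using assms
    by (intro Max_ge finite_steiner_distances) auto
  then show ?thesis using assms(5) by simp
qed

lemma steiner_ecc_le:
  assumes "finite (pverts G)" "v \<in> pverts G" "1 \<le> k" "k \<le> card (pverts G)"
    and "\<And>S. \<lbrakk>S \<subseteq> pverts G; card S = k; v \<in> S\<rbrakk> \<Longrightarrow> steiner_distance G S \<le> n"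
  shows "steiner_ecc k G v \<le> n"
proof -
  \<comment> \<open>\<open>Max\<close> says nothing useful about an empty set, so some
    \<open>k\<close>-set containing \<open>v\<close> must be exhibited.\<close>
  have "k - 1 \<le> card (pverts G - {v})" using assms by simp
  then obtain T where T: "T \<subseteq> pverts G - {v}" "card T = k - 1" "finite T"
    by (rule obtain_subset_with_card_n)
  have "card (insert v T) = k" using T assms(3) by (subst card_insert_disjoint) auto
  then have "{steiner_distance G S | S. S \<subseteq> pverts G \<and> card S = k \<and> v \<in> S} \<noteq> {}"
    using T(1) assms(2) by blast
  then show ?thesis
    unfolding steiner_ecc_def using assms
    by (subst Max_le_iff) (auto intro: finite_steiner_distances)
qed

section \<open>Connected vertex sets of $G_k$\<close>

lemma parcs_Gk: "parcs (Gk k) = gk_edges k \<union> (gk_edges k)\<inverse>"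
  by (simp add: Gk_def)

lemma pverts_Gk: "pverts (Gk k) = D ` {1..k} \<union> A ` {1..gk_m k} \<union> B ` {gk_m k..k} \<union> {R}"
  by (simp add: Gk_def)

text \<open>Cut around the single vertex \<open>D j\<close>. The index differs from \<open>j\<close>
  because \<open>A j\<close> and \<open>B j\<close> are the vertices that skip
  \<open>D j\<close>.\<close>

lemma Gk_neighbour:
  assumes "cut_connected (parcs (Gk k)) W" "D j \<in> W" "w \<in> W" "w \<noteq> D j"
  shows "(\<exists>i. A i \<in> W \<and> i \<noteq> j \<and> j \<le> gk_m k) \<or> (\<exists>i. B i \<in> W \<and> i \<noteq> j \<and> gk_m k \<le> j)"
  using assms(1,2) _ assms(3)
  by (rule cut_connectedE[where X = "{D j}"])
    (use assms in \<open>auto simp: parcs_Gk gk_edges_def\<close>)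

text \<open>Cut off the \<open>A\<close> side without \<open>D (gk_m k)\<close>. Once
  \<open>R\<close> is excluded, the only edges leaving it join some \<open>A i\<close> to
  \<open>D (gk_m k)\<close>, and these have \<open>i \<noteq> gk_m k\<close>.\<close>

lemma Gk_bridge_A:
  assumes "cut_connected (parcs (Gk k)) W" "R \<notin> W" "D 1 \<in> W" "D k \<in> W"
    and "1 < gk_m k" "gk_m k < k"
  shows "D (gk_m k) \<in> W \<and> (\<exists>i. A i \<in> W \<and> i \<noteq> gk_m k)"
  using assms(1,3) _ assms(4)
  by (rule cut_connectedE[where X = "range A \<union> D ` {..<gk_m k}"])
    (use assms in \<open>auto simp: parcs_Gk gk_edges_def image_iff le_less\<close>)

text \<open>The mirror-image cut, around the \<open>B\<close> side without
  \<open>D (gk_m k)\<close>.\<close>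

lemma Gk_bridge_B:
  assumes "cut_connected (parcs (Gk k)) W" "R \<notin> W" "D 1 \<in> W" "D k \<in> W"
    and "1 < gk_m k" "gk_m k < k"
  shows "\<exists>j. B j \<in> W \<and> j \<noteq> gk_m k"
  using assms(1,4) _ assms(3)
  by (rule cut_connectedE[where X = "range B \<union> D ` {gk_m k<..}"])
    (use assms in \<open>auto simp: parcs_Gk gk_edges_def\<close>)

lemma card_le_of_subset_D:
  assumes "finite W" "D ` I \<subseteq> W" "Y \<subseteq> W" "Y \<inter> range D = {}" "finite I"
  shows "card I + card Y \<le> card W"
proof -
  have "card (D ` I \<union> Y) = card I + card Y"
    using assms by (subst card_Un_disjoint) (auto simp: card_image inj_on_def intro: finite_subset)
  then show ?thesis using assms by (metis Un_least card_mono)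
qed

text \<open>With \<open>R\<close>, the \<open>k - 1\<close> given vertices are joined by
  \<open>R\<close>, an \<open>A\<close> and a \<open>B\<close>. Without \<open>R\<close>, the bridge
  forces \<open>D (gk_m k)\<close> in its place, so the count is the same.\<close>

lemma Gk_card_ge_outer:
  assumes k: "k \<ge> 5" and W: "W \<subseteq> pverts (Gk k)" "cut_connected (parcs (Gk k)) W"
    and DW: "D ` ({1..k} - {gk_m k}) \<subseteq> W"
  shows "k + 2 \<le> card W"
proof -
  note m = gk_m_bounds[OF k]
  have fin: "finite W" using W(1) by (rule finite_subset) (simp add: pverts_Gk)
  have D: "D 1 \<in> W" "D k \<in> W" using DW m by auto
  \<comment> \<open>Since \<open>1 < gk_m k < k\<close>, \<open>D 1\<close> has neighbours only in
    \<open>A\<close> and \<open>D k\<close> only in \<open>B\<close>.\<close>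
  obtain i where i: "A i \<in> W" using Gk_neighbour[OF W(2) D] m by auto
  obtain j where j: "B j \<in> W" using Gk_neighbour[OF W(2) D(2,1)] m by auto
  show ?thesis
  proof (cases "R \<in> W")
    case True
    have "card ({1..k} - {gk_m k}) + card {R, A i, B j} \<le> card W"
      using fin DW i j True by (intro card_le_of_subset_D) auto
    moreover have "card ({1..k} - {gk_m k}) = k - 1" using m by (subst card_Diff_singleton) auto
    ultimately show ?thesis using k by simp
  next
    case False
    then have "D (gk_m k) \<in> W" using Gk_bridge_A[OF W(2) False D] m by simp
    then have "card {1..k} + card {A i, B j} \<le> card W"
      using fin DW i j by (intro card_le_of_subset_D) auto
    then show ?thesis by simp
  qed
qed

text \<open>Besides the \<open>k\<close> vertices \<open>D j\<close>, four others are forced: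
  \<open>R\<close> with three from \<open>A\<close> and \<open>B\<close>, or two from each of
  \<open>A\<close> and \<open>B\<close>.\<close>

lemma Gk_card_ge_all:
  assumes k: "k \<ge> 5" and W: "W \<subseteq> pverts (Gk k)" "cut_connected (parcs (Gk k)) W"
    and DW: "D ` {1..k} \<subseteq> W"
  shows "k + 4 \<le> card W"
proof -
  note m = gk_m_bounds[OF k]
  have fin: "finite W" using W(1) by (rule finite_subset) (simp add: pverts_Gk)
  have D: "D 1 \<in> W" "D k \<in> W" "D (gk_m k) \<in> W" using DW m by auto
  \<comment> \<open>For \<open>i < gk_m k\<close>, \<open>D i\<close> has neighbours only in
    \<open>A\<close>, and \<open>A i\<close> is not one of them.\<close>
  have A_other: "\<exists>i'. A i' \<in> W \<and> i' \<noteq> i" if "A i \<in> W" "i \<noteq> gk_m k" for i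
  proof -
    have i: "1 \<le> i" "i < gk_m k" using that W(1) by (auto simp: pverts_Gk)
    then have "D i \<in> W" using DW m by auto
    from Gk_neighbour[OF W(2) this that(1)] i show ?thesis by auto
  qed
  have B_other: "\<exists>j'. B j' \<in> W \<and> j' \<noteq> j" if "B j \<in> W" "j \<noteq> gk_m k" for j
  proof -
    have j: "gk_m k < j" "j \<le> k" using that W(1) by (auto simp: pverts_Gk)
    then have "D j \<in> W" using DW m by auto
    from Gk_neighbour[OF W(2) this that(1)] j show ?thesis by auto
  qed
  have suffices: ?thesis if "Y \<subseteq> W" "Y \<inter> range D = {}" "card Y = 4" for Y
    using card_le_of_subset_D[OF fin DW that(1,2)] that(3) by simp
  show ?thesis
  proof (cases "R \<in> W")
    case True
    obtain i where i: "A i \<in> W" using Gk_neighbour[OF W(2) D(1,2)] m by auto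
    obtain j where j: "B j \<in> W" using Gk_neighbour[OF W(2) D(2,1)] m by auto
    \<comment> \<open>A sole \<open>A\<close> and a sole \<open>B\<close> would, by
      \<open>A_other\<close> and \<open>B_other\<close>, both have index \<open>gk_m k\<close>; then
      \<open>D (gk_m k)\<close> would have no neighbour in \<open>W\<close>.\<close>
    have "(\<exists>i'. A i' \<in> W \<and> i' \<noteq> i) \<or> (\<exists>j'. B j' \<in> W \<and> j' \<noteq> j)"
      using A_other[OF i] B_other[OF j] Gk_neighbour[OF W(2) D(3,1)] m by auto
    then show ?thesis
    proof (elim disjE exE conjE)
      fix i' assume "A i' \<in> W" "i' \<noteq> i"
      then show ?thesis using True i j by (intro suffices[of "{R, A i, A i', B j}"]) auto
    next
      fix j' assume "B j' \<in> W" "j' \<noteq> j"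
      then show ?thesis using True i j by (intro suffices[of "{R, A i, B j, B j'}"]) auto
    qed
  next
    case False
    \<comment> \<open>The bridges supply indices other than \<open>gk_m k\<close>, so each side
      needs a second vertex.\<close>
    obtain i where i: "A i \<in> W" "i \<noteq> gk_m k"
      using Gk_bridge_A[OF W(2) False D(1,2)] m by auto
    obtain j where j: "B j \<in> W" "j \<noteq> gk_m k"
      using Gk_bridge_B[OF W(2) False D(1,2)] m by auto
    obtain i' where i': "A i' \<in> W" "i' \<noteq> i" using A_other[OF i] by blast
    obtain j' where j': "B j' \<in> W" "j' \<noteq> j" using B_other[OF j] by blast
    show ?thesis using i i' j j' by (intro suffices[of "{A i, A i', B j, B j'}"]) auto
  qed
qed

section \<open>Steiner distances in $G_k$\<close>

text \<open>A tree of depth two: \<open>R\<close> is the root, the vertices of \<open>A\<close> and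
  \<open>B\<close> hang from it, and each \<open>D j\<close> hangs from a dominating vertex in
  \<open>Y\<close>. The rank is the depth.\<close>

lemma Gk_steiner_distance_le:
  assumes k: "k \<ge> 5" and S: "S \<subseteq> pverts (Gk k)"
    and Y: "Y \<subseteq> A ` {1..gk_m k} \<union> B ` {gk_m k..k}"
    and dom: "\<And>j. D j \<in> S \<Longrightarrow> \<exists>y\<in>Y. (y, D j) \<in> gk_edges k"
  shows "steiner_distance (Gk k) S \<le> card (insert R (S \<union> Y)) - 1"
proof (rule steiner_distance_le[where c = R and f = "case_gk_vertex (\<lambda>_. 2) (\<lambda>_. 1) (\<lambda>_. 1) 0"])
  show "pair_graph (Gk k)" using k by (rule pair_graph_Gk)
  show "insert R (S \<union> Y) \<subseteq> pverts (Gk k)" using S Y by (auto simp: pverts_Gk)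
  fix w assume w: "w \<in> insert R (S \<union> Y)" "w \<noteq> R"
  show "\<exists>q\<in>insert R (S \<union> Y). (w, q) \<in> parcs (Gk k) \<and>
      case_gk_vertex (\<lambda>_. 2) (\<lambda>_. 1) (\<lambda>_. 1) 0 q
        < (case_gk_vertex (\<lambda>_. 2) (\<lambda>_. 1) (\<lambda>_. 1) 0 w :: nat)"
  proof (cases w)
    case (D j)
    then have "D j \<in> S" using w Y by auto
    then obtain y where "y \<in> Y" "(y, D j) \<in> gk_edges k" using dom by blast
    then show ?thesis using D Y by (intro bexI[of _ y]) (auto simp: parcs_Gk)
  qed (use w S Y in \<open>auto simp: parcs_Gk pverts_Gk gk_edges_def\<close>)
qed auto

lemma Gk_dominating_pair:
  assumes k: "k \<ge> 5" and i: "i \<in> {1..k}"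
  obtains a b where "a \<in> {1..gk_m k}" "b \<in> {gk_m k..k}"
    "\<And>j. \<lbrakk>j \<in> {1..k}; j \<noteq> i\<rbrakk> \<Longrightarrow> \<exists>y\<in>{A a, B b}. (y, D j) \<in> gk_edges k"
proof
  note m = gk_m_bounds[OF k]
  \<comment> \<open>For \<open>i \<le> gk_m k\<close> this is \<open>A i\<close> with
    \<open>B (gk_m k)\<close>, otherwise \<open>A (gk_m k)\<close> with \<open>B i\<close>. The
    vertex of index \<open>i\<close> skips only \<open>D i\<close> on its side; a
    \<open>D (gk_m k)\<close> skipped by the other one is covered by it.\<close>
  let ?a = "min i (gk_m k)" and ?b = "max i (gk_m k)"
  show "?a \<in> {1..gk_m k}" "?b \<in> {gk_m k..k}" using i m by auto
  show "\<exists>y\<in>{A ?a, B ?b}. (y, D j) \<in> gk_edges k" if "j \<in> {1..k}" "j \<noteq> i" for j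
    using that i m by (auto simp: gk_edges_def min_def max_def)
qed

text \<open>The dominating pair for \<open>i\<close> adds at most two vertices, and a tree has one
  edge fewer than vertices. Keeping \<open>insert R S\<close> in the bound lets a set already
  containing \<open>R\<close> save one.\<close>

lemma Gk_steiner_distance_le_missing:
  assumes k: "k \<ge> 5" and S: "S \<subseteq> pverts (Gk k)" and i: "i \<in> {1..k}" "D i \<notin> S"
  shows "steiner_distance (Gk k) S \<le> card (insert R S) + 1"
proof -
  obtain a b where ab: "a \<in> {1..gk_m k}" "b \<in> {gk_m k..k}"
    "\<And>j. \<lbrakk>j \<in> {1..k}; j \<noteq> i\<rbrakk> \<Longrightarrow> \<exists>y\<in>{A a, B b}. (y, D j) \<in> gk_edges k"
    using Gk_dominating_pair[OF k i(1)] by blast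
  have "steiner_distance (Gk k) S \<le> card (insert R (S \<union> {A a, B b})) - 1"
  proof (rule Gk_steiner_distance_le[OF k S])
    fix j assume "D j \<in> S"
    then have "j \<in> {1..k}" "j \<noteq> i" using S i by (auto simp: pverts_Gk)
    then show "\<exists>y\<in>{A a, B b}. (y, D j) \<in> gk_edges k" by (rule ab(3))
  qed (use ab in auto)
  moreover have "card (insert R S \<union> {A a, B b}) \<le> card (insert R S) + card {A a, B b}"
    by (rule card_Un_le)
  then have "card (insert R (S \<union> {A a, B b})) \<le> card (insert R S) + 2"
    by (simp add: insert_commute)
  ultimately show ?thesis by simp
qed

lemma Gk_steiner_distance_D_le:
  assumes k: "k \<ge> 5"
  shows "steiner_distance (Gk k) (D ` {1..k}) \<le> k + 3"
proof -
  note m = gk_m_bounds[OF k]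
  \<comment> \<open>\<open>A 2\<close> repairs \<open>D 1\<close>, the one vertex of its side that
    \<open>A 1\<close> skips; \<open>B (gk_m k)\<close> covers all indices above
    \<open>gk_m k\<close>.\<close>
  let ?Y = "{A 1, A 2, B (gk_m k)}"
  have "steiner_distance (Gk k) (D ` {1..k}) \<le> card (insert R (D ` {1..k} \<union> ?Y)) - 1"
  proof (rule Gk_steiner_distance_le[OF k])
    fix j assume "D j \<in> D ` {1..k}"
    then show "\<exists>y\<in>?Y. (y, D j) \<in> gk_edges k"
      using m by (cases "j = 1"; cases "j \<le> gk_m k") (auto simp: gk_edges_def)
  qed (use m in \<open>auto simp: pverts_Gk\<close>)
  moreover have "card (D ` {1..k} \<union> insert R ?Y) \<le> card (D ` {1..k}) + card (insert R ?Y)"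
    by (rule card_Un_le)
  then have "card (insert R (D ` {1..k} \<union> ?Y)) \<le> k + 4"
    by (simp add: card_image inj_on_def)
  ultimately show ?thesis by simp
qed

section \<open>Eccentricities in \<open>Gk k\<close>\<close>

lemma finite_pverts_Gk: "finite (pverts (Gk k))"
  by (simp add: pverts_Gk)

lemma Gk_steiner_ecc_le:
  assumes k: "k \<ge> 5" and v: "v \<in> pverts (Gk k)"
  shows "steiner_ecc k (Gk k) v \<le> k + 3"
proof (rule steiner_ecc_le[OF finite_pverts_Gk v])
  fix S assume S: "S \<subseteq> pverts (Gk k)" "card S = k"
  have fin: "finite S" using S(1) finite_pverts_Gk by (rule finite_subset)
  show "steiner_distance (Gk k) S \<le> k + 3"
  proof (cases "D ` {1..k} \<subseteq> S")
    case True
    then have "S = D ` {1..k}"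
      using fin S(2) by (intro sym[OF card_subset_eq]) (auto simp: card_image inj_on_def)
    then show ?thesis using Gk_steiner_distance_D_le[OF k] by simp
  next
    case False
    then obtain i where "i \<in> {1..k}" "D i \<notin> S" by blast
    from Gk_steiner_distance_le_missing[OF k S(1) this] show ?thesis
      using card_insert_le_m1[of "k + 1" S R] S(2) by simp
  qed
qed (use k card_pverts_Gk[OF k] in simp_all)

text \<open>\<open>R\<close> occupies one of the \<open>k\<close> places, so some \<open>D i\<close>
  is missing, and joining through \<open>R\<close> costs no extra vertex.\<close>

lemma Gk_steiner_ecc_R_le:
  assumes k: "k \<ge> 5"
  shows "steiner_ecc k (Gk k) R \<le> k + 1"
proof (rule steiner_ecc_le[OF finite_pverts_Gk])
  fix S assume S: "S \<subseteq> pverts (Gk k)" "card S = k" "R \<in> S"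
  have fin: "finite S" using S(1) finite_pverts_Gk by (rule finite_subset)
  have "\<not> D ` {1..k} \<subseteq> S - {R}"
  proof
    assume "D ` {1..k} \<subseteq> S - {R}"
    then have "card (D ` {1..k}) \<le> card (S - {R})" using fin by (intro card_mono) auto
    then show False using S k fin by (simp add: card_image inj_on_def)
  qed
  then obtain i where "i \<in> {1..k}" "D i \<notin> S" by blast
  from Gk_steiner_distance_le_missing[OF k S(1) this] show "steiner_distance (Gk k) S \<le> k + 1"
    using S by (simp add: insert_absorb)
qed (use k card_pverts_Gk[OF k] in \<open>simp_all add: pverts_Gk\<close>)

lemma Gk_steiner_ecc_D_ge:
  assumes k: "k \<ge> 5" and i: "i \<in> {1..k}"
  shows "k + 3 \<le> steiner_ecc k (Gk k) (D i)"
proof (rule le_steiner_ecc[OF finite_pverts_Gk])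
  show "D ` {1..k} \<subseteq> pverts (Gk k)" by (auto simp: pverts_Gk)
  then show "k + 3 \<le> steiner_distance (Gk k) (D ` {1..k})"
    using Gk_card_ge_all[OF k]
    by (intro le_steiner_distance pair_graph_Gk connected_Gk k) (simp_all add: add.commute)
qed (use i in \<open>auto simp: card_image inj_on_def\<close>)

text \<open>A vertex \<open>v\<close> outside the \<open>D i\<close> is completed to a
  \<open>k\<close>-set by all \<open>D i\<close> except \<open>D (gk_m k)\<close>, where the bound
  of \<open>k + 2\<close> vertices applies.\<close>

lemma Gk_steiner_ecc_ge:
  assumes k: "k \<ge> 5" and v: "v \<in> pverts (Gk k)"
  shows "k + 1 \<le> steiner_ecc k (Gk k) v"
proof (cases "v \<in> D ` {1..k}")
  case True
  then show ?thesis using Gk_steiner_ecc_D_ge[OF k] by fastforce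
next
  case False
  note m = gk_m_bounds[OF k]
  let ?S = "insert v (D ` ({1..k} - {gk_m k}))"
  show ?thesis
  proof (rule le_steiner_ecc[OF finite_pverts_Gk])
    show sub: "?S \<subseteq> pverts (Gk k)" using v by (auto simp: pverts_Gk)
    have "card (D ` ({1..k} - {gk_m k})) = k - 1"
      using m by (subst card_image) (auto simp: inj_on_def)
    then show "card ?S = k" using False k by (subst card_insert_disjoint) auto
    show "k + 1 \<le> steiner_distance (Gk k) ?S"
      using Gk_card_ge_outer[OF k] sub
      by (intro le_steiner_distance pair_graph_Gk connected_Gk k) simp_all
  qed simp
qed

theorem proposition10:
  fixes k :: nat
  assumes "k \<ge> 5"
  shows "sdiam k (Gk k) = k + 3 \<and> srad k (Gk k) = k + 1"
proof
  let ?ecc = "steiner_ecc k (Gk k)"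
  have fin: "finite (?ecc ` pverts (Gk k))" using finite_pverts_Gk by simp
  have "?ecc (D 1) = k + 3"
    using assms Gk_steiner_ecc_D_ge[of k 1] Gk_steiner_ecc_le[of k "D 1"]
    by (auto simp: pverts_Gk intro: antisym)
  moreover have "D 1 \<in> pverts (Gk k)" using assms by (simp add: pverts_Gk)
  ultimately show "sdiam k (Gk k) = k + 3"
    unfolding sdiam_def using fin Gk_steiner_ecc_le[OF assms]
    by (intro Max_eqI) (auto intro: rev_image_eqI)
  have R: "R \<in> pverts (Gk k)" by (simp add: pverts_Gk)
  \<comment> \<open>The minimum is attained at \<open>R\<close>, as the maximum was at
    \<open>D 1\<close>.\<close>
  then have "?ecc R = k + 1"
    using Gk_steiner_ecc_R_le[OF assms] Gk_steiner_ecc_ge[OF assms R] by simp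
  then show "srad k (Gk k) = k + 1"
    unfolding srad_def using fin R Gk_steiner_ecc_ge[OF assms]
    by (intro Min_eqI) (auto intro: rev_image_eqI)
qed

end
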